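(* Let $k$ be a non-negative integer and let $G\in\Delta_k$. Then $G$ has linear rank-width larger than $k$. Moreover, every vertex-minor $H$ of $G$ with $|V(H)|=|V(G)|-1$ has linear rank-width at most $k$.
   Context: All graphs are finite and simple. For $X\subseteq V(G)$, $\mathrm{cutrk}_G(X)$ is the rank over the binary field of the submatrix of the adjacency matrix of $G$ with rows $X$ and columns $V(G)\setminus X$. A linear layout of $G$ is an ordering $(v_1,\dots,v_n)$ of $V(G)$. Its width is $\max_i \mathrm{cutrk}_G(\{v_1,\dots,v_i\})$, or $0$ if $n\le1$. The linear rank-width of $G$ is the minimum width of a linear layout. $G*v$ denotes local complementation at $v$: the induced subgraph on the neighborhood of $v$ is replaced by its complement. A vertex-minor of $G$ is any graph obtainable from $G$ by a sequence of vertex deletions and local complementations. A delta composition of graphs $G_1,G_2,G_3$ is obtained from their disjoint union by choosing $v_i\in V(G_i)$ for $i=1,2,3$ and adding the triangle $v_1v_2v_3$, called the main triangle. $\Delta_0=\{K_2\}$. For $i\ge1$, $\Delta_i$ is the set of all delta compositions of three (not necessarily distinct) graphs in $\Delta_{i-1}$. Membership in $\Delta_i$ is understood up to isomorphism. *)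

theory Defs
  imports
    "Graph_Theory.Graph_Theory"
    "HOL-Library.Z2"
    "HOL-Library.Function_Algebras"
begin

text \<open>
  A finite simple graph is a \<^locale>\<open>pair_graph\<close>: an edge between \<open>u\<close> and \<open>v\<close> is represented by
  the two arcs \<open>(u, v)\<close> and \<open>(v, u)\<close>.
\<close>

section \<open>Cut-rank\<close>

global_interpretation fun_space: vector_space "\<lambda>(c :: 'b :: field) (f :: 'a \<Rightarrow> 'b) y. c * f y"
  defines fun_dim = fun_space.dim
  by unfold_locales (auto simp: algebra_simps)

definition adjacency :: "'a pair_pre_digraph \<Rightarrow> 'a \<Rightarrow> 'a \<Rightarrow> bit" where
  "adjacency G x y = of_bool ((x, y) \<in> parcs G)"

text \<open>
  The rank of the submatrix of \<open>M\<close> with rows \<open>X\<close> and columns \<open>Y\<close> is the dimension of its row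
  space. A row of the submatrix, a vector indexed by \<open>Y\<close>, is extended by zero outside \<open>Y\<close>.
\<close>

definition submatrix_rank :: "('a \<Rightarrow> 'b \<Rightarrow> 'c :: field) \<Rightarrow> 'a set \<Rightarrow> 'b set \<Rightarrow> nat" where
  "submatrix_rank M X Y = fun_dim ((\<lambda>x y. if y \<in> Y then M x y else 0) ` X)"

definition cutrk :: "'a pair_pre_digraph \<Rightarrow> 'a set \<Rightarrow> nat" where
  "cutrk G X = submatrix_rank (adjacency G) X (pverts G - X)"

section \<open>Linear rank-width\<close>

definition linear_layout :: "'a pair_pre_digraph \<Rightarrow> 'a list \<Rightarrow> bool" where
  "linear_layout G vs \<longleftrightarrow> distinct vs \<and> set vs = pverts G"

definition layout_width :: "'a pair_pre_digraph \<Rightarrow> 'a list \<Rightarrow> nat" where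
  "layout_width G vs =
    (if length vs \<le> 1 then 0 else Max ((\<lambda>i. cutrk G (set (take i vs))) ` {1..length vs}))"

definition linear_rank_width :: "'a pair_pre_digraph \<Rightarrow> nat" where
  "linear_rank_width G = (LEAST w. \<exists>vs. linear_layout G vs \<and> layout_width G vs = w)"

section \<open>Vertex-minors\<close>

definition delete_vertex :: "'a pair_pre_digraph \<Rightarrow> 'a \<Rightarrow> 'a pair_pre_digraph" where
  "delete_vertex G v =
    \<lparr>pverts = pverts G - {v}, parcs = {(x, y) \<in> parcs G. x \<noteq> v \<and> y \<noteq> v}\<rparr>"

definition neighborhood :: "'a pair_pre_digraph \<Rightarrow> 'a \<Rightarrow> 'a set" where
  "neighborhood G v = {u. (v, u) \<in> parcs G}"

definition local_complement :: "'a pair_pre_digraph \<Rightarrow> 'a \<Rightarrow> 'a pair_pre_digraph" where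
  "local_complement G v = (let N = neighborhood G v in
    \<lparr>pverts = pverts G,
     parcs = (parcs G - N \<times> N) \<union> {(x, y) \<in> N \<times> N. x \<noteq> y \<and> (x, y) \<notin> parcs G}\<rparr>)"

inductive vertex_minor :: "'a pair_pre_digraph \<Rightarrow> 'a pair_pre_digraph \<Rightarrow> bool" where
  refl: "vertex_minor G G"
| delete: "vertex_minor H G \<Longrightarrow> v \<in> pverts H \<Longrightarrow> vertex_minor (delete_vertex H v) G"
| complement: "vertex_minor H G \<Longrightarrow> v \<in> pverts H \<Longrightarrow> vertex_minor (local_complement H v) G"

section \<open>Delta compositions\<close>

abbreviation graph_iso :: "'a pair_pre_digraph \<Rightarrow> 'b pair_pre_digraph \<Rightarrow> bool" where
  "graph_iso G H \<equiv> digraph_iso (with_proj G) (with_proj H)"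

text \<open>
  The disjoint union of \<open>G1\<close>, \<open>G2\<close>, \<open>G3\<close> is formed from isomorphic copies \<open>H1\<close>, \<open>H2\<close>, \<open>H3\<close> with
  pairwise disjoint vertex sets, so \<open>G1\<close>, \<open>G2\<close>, \<open>G3\<close> may overlap or coincide.
\<close>

definition delta_composition ::
  "'a pair_pre_digraph \<Rightarrow> 'a pair_pre_digraph \<Rightarrow> 'a pair_pre_digraph \<Rightarrow> 'a pair_pre_digraph \<Rightarrow> bool"
where
  "delta_composition G1 G2 G3 G \<longleftrightarrow>
    (\<exists>H1 H2 H3 v1 v2 v3.
      graph_iso G1 H1 \<and> graph_iso G2 H2 \<and> graph_iso G3 H3 \<and>
      pverts H1 \<inter> pverts H2 = {} \<and> pverts H1 \<inter> pverts H3 = {} \<and> pverts H2 \<inter> pverts H3 = {} \<and>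
      v1 \<in> pverts H1 \<and> v2 \<in> pverts H2 \<and> v3 \<in> pverts H3 \<and>
      G = \<lparr>pverts = pverts H1 \<union> pverts H2 \<union> pverts H3,
           parcs = parcs H1 \<union> parcs H2 \<union> parcs H3 \<union>
             {(v1, v2), (v2, v1), (v1, v3), (v3, v1), (v2, v3), (v3, v2)}\<rparr>)"

primrec Delta :: "nat \<Rightarrow> 'a pair_pre_digraph set" where
  "Delta 0 = {G. complete_digraph 2 (with_proj G)}"
| "Delta (Suc i) =
    {G. \<exists>G1 \<in> Delta i. \<exists>G2 \<in> Delta i. \<exists>G3 \<in> Delta i. delta_composition G1 G2 G3 G}"

subsection \<open>Closure under isomorphism\<close>

lemma digraph_iso_with_proj_iff:
  fixes G :: "'a pair_pre_digraph" and H :: "'b pair_pre_digraph"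
  shows "graph_iso G H \<longleftrightarrow> pair_wf_digraph G \<and>
    (\<exists>f. inj_on f (pverts G) \<and> pverts H = f ` pverts G \<and> parcs H = map_prod f f ` parcs G)"
    (is "?L \<longleftrightarrow> ?R")
proof
  assume ?L
  then obtain h where h: "pre_digraph.digraph_isomorphism (with_proj G) h"
    and H: "with_proj H = app_iso h (with_proj G)"
    by (auto simp: digraph_iso_def)
  from H have th: "iso_tail h = fst" "iso_head h = snd" and vs: "pverts H = iso_verts h ` pverts G"
    and as: "parcs H = iso_arcs h ` parcs G"
    by (auto simp: with_proj_def app_iso_def)
  have "iso_arcs h a = map_prod (iso_verts h) (iso_verts h) a" if "a \<in> parcs G" for a
    using h that th by (cases a) (auto simp: pre_digraph.digraph_isomorphism_def prod_eq_iff)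
  with as have "parcs H = map_prod (iso_verts h) (iso_verts h) ` parcs G"
    by (metis (no_types, lifting) image_cong)
  with h vs show ?R
    by (auto simp: pre_digraph.digraph_isomorphism_def wf_digraph_wp_iff)
next
  assume ?R
  then obtain f where wf: "pair_wf_digraph G" and f: "inj_on f (pverts G)"
    and H: "pverts H = f ` pverts G" "parcs H = map_prod f f ` parcs G" by blast
  interpret pair_wf_digraph G by (fact wf)
  let ?h = "\<lparr>iso_verts = f, iso_arcs = map_prod f f, iso_head = snd, iso_tail = fst\<rparr>"
  have "inj_on (map_prod f f) (parcs G)"
    using f by (intro inj_on_subset[OF map_prod_inj_on[OF f f]]) (auto dest: in_arcsD1 in_arcsD2)
  then have "pre_digraph.digraph_isomorphism (with_proj G) ?h"
    using f wf by (auto simp: pre_digraph.digraph_isomorphism_def wf_digraph_wp_iff)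
  moreover have "with_proj H = app_iso ?h (with_proj G)"
    using H by (simp add: with_proj_def app_iso_def)
  ultimately show ?L by (auto simp: digraph_iso_def)
qed

lemma pair_graph_iso:
  fixes G :: "'a pair_pre_digraph" and H :: "'b pair_pre_digraph"
  assumes "pair_graph G" "graph_iso G H"
  shows "pair_graph H"
proof -
  interpret pair_graph G by fact
  obtain f where f: "inj_on f (pverts G)"
    and H: "pverts H = f ` pverts G" "parcs H = map_prod f f ` parcs G"
    using assms by (auto simp: digraph_iso_with_proj_iff)
  show ?thesis
  proof
    show "symmetric H"
      unfolding symmetric_def sym_def by (force simp: H dest: arcs_symmetric)
    show "fst e \<noteq> snd e" if e: "e \<in> parcs H" for e
    proof -
      obtain x y where "(x, y) \<in> parcs G" "e = (f x, f y)" using e by (auto simp: H)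
      then show ?thesis
        using pair_no_loops[of "(x, y)"] in_arcsD1[of x y] in_arcsD2[of x y] f
        by (auto dest: inj_onD)
    qed
  qed (use pair_finite_verts pair_finite_arcs in \<open>auto simp: H dest: in_arcsD1 in_arcsD2\<close>)
qed

lemma Delta_pair_graph:
  assumes "G \<in> Delta k" shows "pair_graph G"
  using assms
proof (induction k arbitrary: G)
  case 0
  then show ?case by (auto simp: complete_digraph_def intro: pair_graphI_graph)
next
  case (Suc k)
  then obtain G1 G2 G3 H1 H2 H3 :: "'a pair_pre_digraph" and v1 v2 v3
    where in_Delta: "G1 \<in> Delta k" "G2 \<in> Delta k" "G3 \<in> Delta k"
    and iso: "graph_iso G1 H1" "graph_iso G2 H2" "graph_iso G3 H3"
    and disj: "pverts H1 \<inter> pverts H2 = {}" "pverts H1 \<inter> pverts H3 = {}" "pverts H2 \<inter> pverts H3 = {}"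
    and v: "v1 \<in> pverts H1" "v2 \<in> pverts H2" "v3 \<in> pverts H3"
    and G: "G = \<lparr>pverts = pverts H1 \<union> pverts H2 \<union> pverts H3,
           parcs = parcs H1 \<union> parcs H2 \<union> parcs H3 \<union>
             {(v1, v2), (v2, v1), (v1, v3), (v3, v1), (v2, v3), (v3, v2)}\<rparr>"
    by (auto simp: delta_composition_def)
  interpret H1: pair_graph H1 using Suc.IH[OF in_Delta(1)] iso(1) by (rule pair_graph_iso)
  interpret H2: pair_graph H2 using Suc.IH[OF in_Delta(2)] iso(2) by (rule pair_graph_iso)
  interpret H3: pair_graph H3 using Suc.IH[OF in_Delta(3)] iso(3) by (rule pair_graph_iso)
  show ?case
  proof
    show "symmetric G"
      unfolding symmetric_def sym_def
      by (auto simp: G dest: H1.arcs_symmetric H2.arcs_symmetric H3.arcs_symmetric)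
    show "fst e \<noteq> snd e" if "e \<in> parcs G" for e
      using that v disj by (auto simp: G dest: H1.pair_no_loops H2.pair_no_loops H3.pair_no_loops)
  qed (use v in \<open>auto simp: G dest: H1.in_arcsD1 H1.in_arcsD2 H2.in_arcsD1 H2.in_arcsD2
        H3.in_arcsD1 H3.in_arcsD2\<close>)
qed

lemma Delta_iso:
  fixes G :: "'a pair_pre_digraph" and H :: "'b pair_pre_digraph"
  assumes "G \<in> Delta k" "graph_iso G H"
  shows "H \<in> Delta k"
  using assms
proof (induction k arbitrary: G H)
  case 0
  have "pair_graph G" using 0 by (intro Delta_pair_graph[of _ 0])
  then have H: "graph (with_proj H)"
    using "0.prems"(2) by (metis pair_graph.pair_graphD_graph pair_graph_iso)
  obtain f where f: "inj_on f (pverts G)"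
    and eq: "pverts H = f ` pverts G" "parcs H = map_prod f f ` parcs G"
    using 0 by (auto simp: digraph_iso_with_proj_iff)
  have G: "card (pverts G) = 2" "parcs G = {(u, v). (u, v) \<in> pverts G \<times> pverts G \<and> u \<noteq> v}"
    using 0 by (auto simp: complete_digraph_def)
  have "parcs H = {(u, v). (u, v) \<in> pverts H \<times> pverts H \<and> u \<noteq> v}"
    using f unfolding eq G(2) by (auto simp: inj_on_def)
  then show ?case
    using H f G(1) by (simp add: complete_digraph_def eq card_image)
next
  case (Suc k)
  then obtain G1 G2 G3 H1 H2 H3 :: "'a pair_pre_digraph" and v1 v2 v3
    where in_Delta: "G1 \<in> Delta k" "G2 \<in> Delta k" "G3 \<in> Delta k"
    and iso: "graph_iso G1 H1" "graph_iso G2 H2" "graph_iso G3 H3"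
    and disj: "pverts H1 \<inter> pverts H2 = {}" "pverts H1 \<inter> pverts H3 = {}" "pverts H2 \<inter> pverts H3 = {}"
    and v: "v1 \<in> pverts H1" "v2 \<in> pverts H2" "v3 \<in> pverts H3"
    and G: "G = \<lparr>pverts = pverts H1 \<union> pverts H2 \<union> pverts H3,
           parcs = parcs H1 \<union> parcs H2 \<union> parcs H3 \<union>
             {(v1, v2), (v2, v1), (v1, v3), (v3, v1), (v2, v3), (v3, v2)}\<rparr>"
    by (auto simp: delta_composition_def)
  obtain f where f: "inj_on f (pverts G)"
    and H: "pverts H = f ` pverts G" "parcs H = map_prod f f ` parcs G"
    using Suc.prems by (auto simp: digraph_iso_with_proj_iff)
  define F where "F K = \<lparr>pverts = f ` pverts K, parcs = map_prod f f ` parcs K\<rparr>"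
    for K :: "'a pair_pre_digraph"
  have wf: "pair_wf_digraph K" if "graph_iso L K" "L \<in> Delta k"
    for L K :: "'a pair_pre_digraph"
    using pair_graph_iso[OF Delta_pair_graph[OF that(2)] that(1)]
    by (simp add: pair_graph_def pair_digraph_def pair_fin_digraph_def)
  have FI: "graph_iso L (F K)" if "graph_iso L K" "L \<in> Delta k" "pverts K \<subseteq> pverts G"
    for L K :: "'a pair_pre_digraph"
  proof -
    have "graph_iso K (F K)"
      unfolding digraph_iso_with_proj_iff
      using wf[OF that(1,2)] inj_on_subset[OF f that(3)] by (auto simp: F_def)
    with that(1) show ?thesis by (rule digraph_iso_trans)
  qed
  have refl: "graph_iso (F K) (F K)" if "F K \<in> Delta k" for K
  proof -
    have "pair_wf_digraph (F K)"
      using Delta_pair_graph[OF that] by (simp add: pair_graph_def pair_digraph_def pair_fin_digraph_def)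
    then show ?thesis
      unfolding digraph_iso_with_proj_iff by (intro conjI exI[of _ id]) (auto simp: prod.map_id0)
  qed
  have sub: "pverts H1 \<subseteq> pverts G" "pverts H2 \<subseteq> pverts G" "pverts H3 \<subseteq> pverts G"
    by (auto simp: G)
  have D: "F H1 \<in> Delta k" "F H2 \<in> Delta k" "F H3 \<in> Delta k"
    using Suc.IH FI iso in_Delta sub by blast+
  have disjF: "pverts (F A) \<inter> pverts (F B) = {}"
    if "pverts A \<inter> pverts B = {}" "pverts A \<subseteq> pverts G" "pverts B \<subseteq> pverts G" for A B
    using that f by (simp add: F_def inj_on_image_Int[symmetric])
  have "H = \<lparr>pverts = pverts (F H1) \<union> pverts (F H2) \<union> pverts (F H3),
           parcs = parcs (F H1) \<union> parcs (F H2) \<union> parcs (F H3) \<union>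
             {(f v1, f v2), (f v2, f v1), (f v1, f v3), (f v3, f v1), (f v2, f v3), (f v3, f v2)}\<rparr>"
    by (rule pair_pre_digraph.equality) (simp_all add: H G F_def image_Un)
  moreover have "f v1 \<in> pverts (F H1)" "f v2 \<in> pverts (F H2)" "f v3 \<in> pverts (F H3)"
    using v by (auto simp: F_def)
  ultimately have "delta_composition (F H1) (F H2) (F H3) H"
    unfolding delta_composition_def
    using refl[OF D(1)] refl[OF D(2)] refl[OF D(3)] disjF disj sub by blast
  with D show ?case by auto
qed

end

theory Submission
  imports Defs "HOL-Library.Sublist"
begin

text \<open>
  Lower bound: in a layout of a delta composition of \<open>A\<close>, \<open>B\<close>, \<open>C\<close>, each part has by induction a cut
  whose rank inside the part is large. At the middle one of the three cuts, say that of \<open>B\<close>, the set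
  \<open>A \<union> C\<close> has vertices on both sides; being connected, it provides an edge across the cut. Only one
  vertex of \<open>B\<close> has neighbours in \<open>A \<union> C\<close>, so this edge raises the rank by one.

  Upper bound: up to local equivalence a vertex can be removed in three ways, and local complementation
  permutes them, so it suffices to treat these three removals of a vertex \<open>x\<close>, by induction. Let
  \<open>p\<close>, \<open>q\<close>, \<open>r\<close> be the vertices of the main triangle in the parts \<open>A\<close>, \<open>B\<close>, \<open>C\<close>, and let \<open>x\<close> lie in
  \<open>A\<close>. Concatenate a layout of \<open>B \ q\<close>, the vertex \<open>q\<close>, a layout of a removal of \<open>x\<close> from \<open>A\<close>, the
  vertex \<open>r\<close>, and a reversed layout of \<open>C \ r\<close>. Each cut exceeds the corresponding smaller one by at
  most one; in the middle this is the contribution of the edge \<open>qr\<close>. If \<open>x = p\<close>, clearing that edge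
  exchanges two of the three ways of removing \<open>x\<close> from \<open>A\<close>.
\<close>

section \<open>Rank via factorisations\<close>

text \<open>A bound on the rank is a sum of \<open>r\<close> rank-one terms, so row and column
  operations become changes of \<open>f\<close> or \<open>g\<close>. Lower bounds are expressed as
  negations of \<open>rank_le\<close>.\<close>

definition rank_le :: "('a \<Rightarrow> 'b \<Rightarrow> 'c :: field) \<Rightarrow> 'a set \<Rightarrow> 'b set \<Rightarrow> nat \<Rightarrow> bool" where
  "rank_le M X Y r \<longleftrightarrow> (\<exists>f g. \<forall>x\<in>X. \<forall>y\<in>Y. M x y = (\<Sum>i<r. f i x * g i y))"

lemma rank_leI:
  assumes "\<And>x y. x \<in> X \<Longrightarrow> y \<in> Y \<Longrightarrow> M x y = (\<Sum>i<r. f i x * g i y)"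
  shows "rank_le M X Y r"
  using assms unfolding rank_le_def by blast

lemma rank_leE:
  assumes "rank_le M X Y r"
  obtains f g where "\<And>x y. x \<in> X \<Longrightarrow> y \<in> Y \<Longrightarrow> M x y = (\<Sum>i<r. f i x * g i y)"
  using assms unfolding rank_le_def by blast

lemma rank_le_transpose: "rank_le M X Y r \<Longrightarrow> rank_le (\<lambda>y x. M x y) Y X r"
  by (erule rank_leE) (rule rank_leI[where f = g and g = f for f g], simp add: mult.commute)

lemma rank_le_sym:
  assumes "rank_le M X Y r" "\<And>x y. M x y = M y x"
  shows "rank_le M Y X r"
proof -
  have "(\<lambda>y x. M x y) = M" using assms(2) by blast
  then show ?thesis using rank_le_transpose[OF assms(1)] by simp
qed

lemma rank_le_subset:
  "rank_le M X Y r \<Longrightarrow> X' \<subseteq> X \<Longrightarrow> Y' \<subseteq> Y \<Longrightarrow> rank_le M X' Y' r"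
  unfolding rank_le_def by blast

lemma rank_le_cong:
  assumes "rank_le M X Y r" "\<And>x y. x \<in> X \<Longrightarrow> y \<in> Y \<Longrightarrow> N x y = M x y"
  shows "rank_le N X Y r"
  using assms unfolding rank_le_def by simp

lemma rank_le_mono:
  assumes "rank_le M X Y r" "r \<le> s"
  shows "rank_le M X Y s"
proof -
  obtain f g where *: "\<And>x y. x \<in> X \<Longrightarrow> y \<in> Y \<Longrightarrow> M x y = (\<Sum>i<r. f i x * g i y)"
    using assms(1) unfolding rank_le_def by blast
  show ?thesis
  proof (rule rank_leI)
    fix x y assume "x \<in> X" "y \<in> Y"
    then have "M x y = (\<Sum>i<r. f i x * g i y)" by (rule *)
    also have "\<dots> = (\<Sum>i<s. (if i < r then f i x else 0) * g i y)"
      using assms(2) by (intro sum.mono_neutral_cong_left) auto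
    finally show "M x y = (\<Sum>i<s. (if i < r then f i x else 0) * g i y)" .
  qed
qed

lemma rank_le_empty [simp]: "rank_le M {} Y r" "rank_le M X {} r"
  by (simp_all add: rank_le_def)

lemma rank_le_zero_iff: "rank_le M X Y 0 \<longleftrightarrow> (\<forall>x\<in>X. \<forall>y\<in>Y. M x y = 0)"
  by (simp add: rank_le_def)

lemma rank_le_rank_one_update:
  assumes "rank_le M X Y r"
    and "\<And>x y. x \<in> X \<Longrightarrow> y \<in> Y \<Longrightarrow> N x y = M x y + F x * G y"
  shows "rank_le N X Y (Suc r)"
proof -
  obtain f g where *: "\<And>x y. x \<in> X \<Longrightarrow> y \<in> Y \<Longrightarrow> M x y = (\<Sum>i<r. f i x * g i y)"
    using assms(1) unfolding rank_le_def by blast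
  show ?thesis
    by (rule rank_leI[where f = "\<lambda>i. if i = r then F else f i" and g = "\<lambda>i. if i = r then G else g i"])
      (simp add: assms(2) *)
qed

lemma rank_le_zero_rows:
  assumes "rank_le M X Y r"
    and "\<And>x y. x \<in> X' - X \<Longrightarrow> y \<in> Y \<Longrightarrow> M x y = 0"
  shows "rank_le M X' Y r"
proof -
  obtain f g where *: "\<And>x y. x \<in> X \<Longrightarrow> y \<in> Y \<Longrightarrow> M x y = (\<Sum>i<r. f i x * g i y)"
    using assms(1) unfolding rank_le_def by blast
  show ?thesis
  proof (rule rank_leI)
    fix x y assume "x \<in> X'" "y \<in> Y"
    then show "M x y = (\<Sum>i<r. (if x \<in> X then f i x else 0) * g i y)"
      by (cases "x \<in> X") (simp_all add: * assms(2))
  qed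
qed

lemma rank_le_zero_cols:
  assumes "rank_le M X Y r"
    and "\<And>x y. x \<in> X \<Longrightarrow> y \<in> Y' - Y \<Longrightarrow> M x y = 0"
  shows "rank_le M X Y' r"
  using rank_le_transpose[OF rank_le_zero_rows[OF rank_le_transpose[OF assms(1)], of Y']] assms(2)
  by blast

lemma rank_le_insert_row:
  assumes "rank_le M X Y r"
  shows "rank_le M (insert a X) Y (Suc r)"
proof -
  have "rank_le (\<lambda>x y. if x = a then 0 else M x y) (insert a X) Y r"
    by (rule rank_le_zero_rows[where X = "X - {a}"],
        rule rank_le_cong[OF rank_le_subset[OF assms]]) auto
  then show ?thesis
    by (rule rank_le_rank_one_update[where F = "\<lambda>x. of_bool (x = a)" and G = "M a"]) auto
qed

lemma rank_le_insert_col: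
  assumes "rank_le M X Y r"
  shows "rank_le M X (insert b Y) (Suc r)"
  using rank_le_transpose[OF rank_le_insert_row[OF rank_le_transpose[OF assms]]] .

text \<open>Every new row is a combination of old ones, so the left factors absorb the change and
  \<open>g\<close> stays the same.\<close>

lemma rank_le_row_update:
  assumes "rank_le M X Y r" "u \<in> X"
    and "\<And>x y. x \<in> X \<Longrightarrow> y \<in> Y \<Longrightarrow> N x y = M x y + F x * M u y"
  shows "rank_le N X Y r"
proof -
  obtain f g where *: "\<And>x y. x \<in> X \<Longrightarrow> y \<in> Y \<Longrightarrow> M x y = (\<Sum>i<r. f i x * g i y)"
    using assms(1) unfolding rank_le_def by blast
  show ?thesis
    by (rule rank_leI[where f = "\<lambda>i x. f i x + F x * f i u" and g = g])
      (simp add: assms(2,3) * sum_distrib_left sum.distrib[symmetric] algebra_simps)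
qed

lemma rank_le_col_update:
  assumes "rank_le M X Y r" "u \<in> Y"
    and "\<And>x y. x \<in> X \<Longrightarrow> y \<in> Y \<Longrightarrow> N x y = M x y + M x u * F y"
  shows "rank_le N X Y r"
  by (rule rank_le_transpose[OF rank_le_row_update[OF rank_le_transpose[OF assms(1)] assms(2), where F = F]])
    (simp add: assms(3) mult.commute)

text \<open>Elimination at the pivot \<open>(a, b)\<close> lowers the rank by one. The pivot will be
  the loop at a removed vertex or an edge crossing a cut.\<close>

lemma rank_le_schur_complement:
  assumes "rank_le M X Y (Suc r)" "a \<in> X" "b \<in> Y" "M a b \<noteq> 0"
  shows "rank_le (\<lambda>x y. M x y - M x b * M a y / M a b) X Y r"
proof -
  obtain f g where *: "\<And>x y. x \<in> X \<Longrightarrow> y \<in> Y \<Longrightarrow> M x y = (\<Sum>i<Suc r. f i x * g i y)"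
    using assms(1) unfolding rank_le_def by blast
  have "(\<Sum>i<Suc r. f i a * g i b) \<noteq> 0" using assms * by metis
  then obtain j where j: "j < Suc r" "f j a \<noteq> 0"
    by (metis (no_types, lifting) lessThan_iff mult_zero_left sum.neutral)
  \<comment> \<open>\<open>F\<close> subtracts from row \<open>x\<close> the multiple of row
    \<open>a\<close> that cancels term \<open>j\<close>, so only the \<open>r\<close> terms in
    \<open>J\<close> survive.\<close>
  define F where "F i x = f i x - f j x * f i a / f j a" for i x
  define h where "h x = f j x / f j a" for x
  define J where "J = {..<Suc r} - {j}"
  have eq: "M x y - h x * M a y = (\<Sum>i\<in>J. F i x * g i y)" if "x \<in> X" "y \<in> Y" for x y
  proof -
    have "M x y - h x * M a y = (\<Sum>i<Suc r. F i x * g i y)"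
      unfolding *[OF that] *[OF assms(2) that(2)] F_def h_def sum_distrib_left sum_subtractf[symmetric]
      by (intro sum.cong) (auto simp: algebra_simps)
    also have "\<dots> = (\<Sum>i\<in>J. F i x * g i y)"
      unfolding J_def using j by (subst sum.remove[of _ j]) (auto simp: F_def)
    finally show ?thesis .
  qed
  \<comment> \<open>A column operation with column \<open>b\<close> needs no further term and
    corrects the coefficient of row \<open>a\<close> from \<open>h x\<close> to
    \<open>M x b / M a b\<close>.\<close>
  define G where "G i y = g i y - g i b * M a y / M a b" for i y
  have "M x y - M x b * M a y / M a b = (\<Sum>i\<in>J. F i x * G i y)" if "x \<in> X" "y \<in> Y" for x y
  proof -
    have "M x y - M x b * M a y / M a b
        = (M x y - h x * M a y) - (M x b - h x * M a b) * (M a y / M a b)"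
      using assms(4) by (simp add: field_simps)
    also have "\<dots> = (\<Sum>i\<in>J. F i x * G i y)"
      unfolding eq[OF that] eq[OF that(1) assms(3)] G_def sum_distrib_right sum_subtractf[symmetric]
      by (intro sum.cong) (auto simp: algebra_simps)
    finally show ?thesis .
  qed
  moreover obtain e where "bij_betw e {..<r} J"
    using j ex_bij_betw_nat_finite[of J] by (auto simp: J_def lessThan_atLeast0)
  ultimately show ?thesis
    by (intro rank_leI[where f = "\<lambda>i. F (e i)" and g = "\<lambda>i. G (e i)"])
      (auto simp: sum.reindex_bij_betw[of e, symmetric])
qed

lemma sum_fun_apply: "(\<Sum>i\<in>A. f i) y = (\<Sum>i\<in>A. f i y)"
  by (induction A rule: infinite_finite_induct) auto

text \<open>From left to right, a basis chosen among the rows and the coefficients over it are the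
  factors; from right to left, the rows lie in the span of the functions \<open>g i\<close>,
  extended by zero.\<close>

lemma submatrix_rank_le_iff:
  fixes M :: "'a \<Rightarrow> 'b \<Rightarrow> 'c :: field"
  assumes "finite X"
  shows "submatrix_rank M X Y \<le> r \<longleftrightarrow> rank_le M X Y r"
proof
  let ?row = "\<lambda>x y. if y \<in> Y then M x y else 0"
  obtain B where B: "B \<subseteq> ?row ` X" "?row ` X \<subseteq> fun_space.span B" "card B = submatrix_rank M X Y"
    unfolding submatrix_rank_def by (rule fun_space.basis_exists)
  have fin: "finite B" using B(1) assms finite_subset by blast
  have "\<forall>x\<in>X. \<exists>c. ?row x = (\<Sum>b\<in>B. (\<lambda>y. c b * b y))"
    using B(2) unfolding fun_space.span_finite[OF fin] by blast
  from bchoice[OF this] obtain c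
    where c: "\<forall>x\<in>X. ?row x = (\<Sum>b\<in>B. (\<lambda>y. c x b * b y))" ..
  have M: "M x y = (\<Sum>b\<in>B. c x b * b y)" if "x \<in> X" "y \<in> Y" for x y
    using fun_cong[OF bspec[OF c that(1)], of y] that(2) by (simp add: sum_fun_apply)
  obtain e where e: "bij_betw e {..<card B} B"
    using ex_bij_betw_nat_finite[OF fin] by (auto simp: lessThan_atLeast0)
  have "rank_le M X Y (card B)"
  proof (rule rank_leI)
    fix x y assume "x \<in> X" "y \<in> Y"
    then show "M x y = (\<Sum>i<card B. c x (e i) * e i y)"
      by (simp only: M sum.reindex_bij_betw[OF e, of "\<lambda>b. c x b * b y"])
  qed
  then show "rank_le M X Y r" if "submatrix_rank M X Y \<le> r"
    using B(3) that rank_le_mono by metis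
next
  assume "rank_le M X Y r"
  then obtain f g where *: "\<And>x y. x \<in> X \<Longrightarrow> y \<in> Y \<Longrightarrow> M x y = (\<Sum>i<r. f i x * g i y)"
    unfolding rank_le_def by blast
  define h where "h i y = (if y \<in> Y then g i y else 0)" for i y
  have row: "(\<lambda>y. if y \<in> Y then M x y else 0) = (\<Sum>i<r. (\<lambda>y. f i x * h i y))" if "x \<in> X" for x
    using that by (auto simp: fun_eq_iff sum_fun_apply * h_def)
  have "(\<lambda>x y. if y \<in> Y then M x y else 0) ` X \<subseteq> fun_space.span (h ` {..<r})"
    using row
    by (auto intro!: fun_space.span_sum fun_space.span_scale intro: fun_space.span_base)
  then have "submatrix_rank M X Y \<le> card (h ` {..<r})"
    unfolding submatrix_rank_def by (rule fun_space.dim_le_card) simp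
  also have "\<dots> \<le> r" using card_image_le[of "{..<r}" h] by simp
  finally show "submatrix_rank M X Y \<le> r" .
qed

section \<open>Cuts of the graphs obtained by removing one vertex\<close>

definition set_diag :: "('a \<Rightarrow> 'a \<Rightarrow> 'b) \<Rightarrow> 'a \<Rightarrow> 'b \<Rightarrow> 'a \<Rightarrow> 'a \<Rightarrow> 'b" where
  "set_diag a v t = (\<lambda>x y. if x = v \<and> y = v then t else a x y)"

text \<open>
  Up to local equivalence, a vertex \<open>v\<close> can be removed from \<open>G\<close> in three ways: \<open>G \ v\<close>, \<open>G * v \ v\<close>
  and \<open>G \<and> vw \ v\<close>, where \<open>w\<close> is a neighbour of \<open>v\<close>. Their cut-ranks at \<open>X\<close> are the rank of
  \<open>A[X, V - v - X]\<close>, and one less than the rank of \<open>A[X + v, V - X]\<close> with the entry at \<open>(v, v)\<close>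
  replaced by \<open>1\<close> and by \<open>0\<close>, respectively.
\<close>

primrec minor_cut_le ::
  "bit option \<Rightarrow> ('a \<Rightarrow> 'a \<Rightarrow> bit) \<Rightarrow> 'a set \<Rightarrow> 'a \<Rightarrow> 'a set \<Rightarrow> nat \<Rightarrow> bool"
where
  "minor_cut_le None a V v X r \<longleftrightarrow> rank_le a X (V - {v} - X) r"
| "minor_cut_le (Some t) a V v X r \<longleftrightarrow> rank_le (set_diag a v t) (insert v X) (V - X) (Suc r)"

text \<open>Deletion only drops a column. In the other two cases row \<open>v\<close> may raise the
  rank by one, which the offset in \<open>minor_cut_le\<close> pays for.\<close>

lemma minor_cut_le_if_rank_le:
  assumes "rank_le a X (V - X) r" "v \<notin> X"
  shows "minor_cut_le \<sigma> a V v X r"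
proof (cases \<sigma>)
  case None
  then show ?thesis using rank_le_subset[OF assms(1), of X "V - {v} - X"] by auto
next
  case (Some t)
  have "rank_le (set_diag a v t) X (V - X) r"
    by (rule rank_le_cong[OF assms(1)]) (use assms(2) in \<open>auto simp: set_diag_def\<close>)
  then show ?thesis using Some by (simp add: rank_le_insert_row)
qed

text \<open>Complementing \<open>X\<close> in \<open>V - {v}\<close> exchanges
  \<open>insert v X\<close> with \<open>V - X\<close>, which transposes the matrix.\<close>

lemma minor_cut_le_compl:
  assumes "\<And>x y. a x y = a y x" "v \<in> V" "X \<subseteq> V - {v}" "minor_cut_le \<sigma> a V v (V - {v} - X) r"
  shows "minor_cut_le \<sigma> a V v X r"
proof (cases \<sigma>)
  case None
  moreover have "V - {v} - (V - {v} - X) = X" using assms(3) by blast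
  ultimately show ?thesis using assms(1,4) by (simp add: rank_le_sym)
next
  case (Some t)
  moreover have "V - (V - {v} - X) = insert v X" "insert v (V - {v} - X) = V - X"
    using assms(2,3) by auto
  ultimately show ?thesis
    using assms(4) by (auto intro!: rank_le_sym simp: set_diag_def assms(1))
qed

section \<open>Local complementation acting on the three removals\<close>

definition loopless_symmetric :: "('a \<Rightarrow> 'a \<Rightarrow> 'b :: zero) \<Rightarrow> bool" where
  "loopless_symmetric a \<longleftrightarrow> (\<forall>x y. a x y = a y x) \<and> (\<forall>x. a x x = 0)"

text \<open>Over the binary field, adding the product \<open>a u x * a u y\<close> toggles exactly
  the pairs of neighbours of \<open>u\<close>.\<close>

definition local_compl_matrix :: "('a \<Rightarrow> 'a \<Rightarrow> bit) \<Rightarrow> 'a \<Rightarrow> 'a \<Rightarrow> 'a \<Rightarrow> bit" where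
  "local_compl_matrix a u = (\<lambda>x y. if x = y then 0 else a x y + a u x * a u y)"

lemma loopless_symmetric_local_compl:
  "loopless_symmetric a \<Longrightarrow> loopless_symmetric (local_compl_matrix a u)"
  by (auto simp: loopless_symmetric_def local_compl_matrix_def mult.commute)

text \<open>Away from the diagonal, local complementation adds row \<open>u\<close> to the rows of
  its neighbours, or does the same with columns.\<close>

lemma rank_le_local_compl:
  assumes "loopless_symmetric a" "u \<in> X \<union> Y" "X \<inter> Y = {}" "rank_le a X Y r"
  shows "rank_le (local_compl_matrix a u) X Y r"
proof (cases "u \<in> X")
  case True
  show ?thesis
    by (rule rank_le_row_update[OF assms(4) True, where F = "a u"])
      (use assms(3) in \<open>auto simp: local_compl_matrix_def\<close>)
next
  case False
  then have "u \<in> Y" using assms(2) by blast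
  then show ?thesis
    by (rule rank_le_col_update[OF assms(4), where F = "a u"])
      (use assms(1,3) in \<open>auto simp: local_compl_matrix_def loopless_symmetric_def\<close>)
qed

lemma minor_cut_le_local_compl_self:
  assumes a: "loopless_symmetric a" and v: "v \<in> V" and X: "X \<subseteq> V - {v}"
    and le: "minor_cut_le (case \<sigma> of None \<Rightarrow> Some 1 | Some t \<Rightarrow> if t = 0 then Some 0 else None) a V v X r"
  shows "minor_cut_le \<sigma> (local_compl_matrix a v) V v X r"
proof -
  have sym: "x \<noteq> v \<Longrightarrow> a x v = a v x" and loop: "a x x = 0" for x
    using a by (auto simp: loopless_symmetric_def)
  consider "\<sigma> = None" | "\<sigma> = Some 0" | "\<sigma> = Some 1"
    by (metis (full_types) bit_not_one_iff not_None_eq)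
  then show ?thesis
  proof cases
    case 1
    let ?M = "set_diag a v 1"
    \<comment> \<open>With a loop at \<open>v\<close> as pivot, the Schur complement adds
      \<open>a v x * a v y\<close>, which is local complementation at \<open>v\<close>.\<close>
    have "rank_le (\<lambda>x y. ?M x y - ?M x v * ?M v y / ?M v v) (insert v X) (V - X) r"
      by (rule rank_le_schur_complement) (use 1 le v X in \<open>auto simp: set_diag_def\<close>)
    then have "rank_le (\<lambda>x y. ?M x y - ?M x v * ?M v y / ?M v v) X (V - {v} - X) r"
      by (rule rank_le_subset) auto
    then show ?thesis
      unfolding 1 minor_cut_le.simps
      by (rule rank_le_cong) (use X in \<open>auto simp: set_diag_def local_compl_matrix_def sym loop\<close>)
  next
    case 2
    have "rank_le (set_diag a v 0) (insert v X) (V - X) (Suc r)"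
      using 2 le by simp
    then show ?thesis
      unfolding 2 minor_cut_le.simps
      by (rule rank_le_row_update[where u = v and F = "a v"])
        (auto simp: set_diag_def local_compl_matrix_def loop)
  next
    case 3
    \<comment> \<open>\<open>?M\<close> isolates \<open>v\<close>; the outer product of
      \<open>?h\<close>, the indicator of the closed neighbourhood of \<open>v\<close>, restores row
      and column \<open>v\<close>, complements the neighbourhood and puts the loop at
      \<open>v\<close>.\<close>
    let ?M = "\<lambda>x y. if x = v \<or> y = v then 0 else a x y"
    let ?h = "\<lambda>x. if x = v then 1 else a v x"
    have "rank_le a X (V - {v} - X) r"
      using 3 le by simp
    then have "rank_le ?M X (V - {v} - X) r"
      by (rule rank_le_cong) (use X in auto)
    then have "rank_le ?M X (V - X) r"
      by (rule rank_le_zero_cols) auto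
    then have "rank_le ?M (insert v X) (V - X) r"
      by (rule rank_le_zero_rows) auto
    then show ?thesis
      unfolding 3 minor_cut_le.simps
      by (rule rank_le_rank_one_update[where F = ?h and G = ?h])
        (use X in \<open>auto simp: set_diag_def local_compl_matrix_def loop sym\<close>)
  qed
qed

text \<open>Adding row \<open>u\<close> to the rows of its neighbours also changes the diagonal
  entry at \<open>v\<close> by \<open>a u v\<close>. Hence the two removals with a diagonal entry
  are exchanged exactly when \<open>u\<close> and \<open>v\<close> are adjacent.\<close>

lemma minor_cut_le_local_compl_other:
  assumes a: "loopless_symmetric a" and uv: "u \<in> V" "v \<in> V" "u \<noteq> v" and X: "X \<subseteq> V - {v}"
    and le: "minor_cut_le (map_option (\<lambda>t. t + a u v) \<sigma>) a V v X r"
  shows "minor_cut_le \<sigma> (local_compl_matrix a u) V v X r"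
proof (cases \<sigma>)
  case None
  then show ?thesis
    using rank_le_local_compl[OF a, of u X "V - {v} - X" r] uv X le by auto
next
  case (Some t)
  let ?M = "set_diag a v (t + a u v)" and ?N = "set_diag (local_compl_matrix a u) v t"
  have sym: "a x y = a y x" and loop: "a x x = 0" for x y
    using a by (auto simp: loopless_symmetric_def)
  have M: "rank_le ?M (insert v X) (V - X) (Suc r)"
    using Some le by simp
  have N: "?N x y = ?M x y + a u x * a u y" if "x \<in> insert v X" "y \<in> V - X" for x y
    using that X by (cases "a u v") (auto simp: set_diag_def local_compl_matrix_def loop)
  have "rank_le ?N (insert v X) (V - X) (Suc r)"
  proof (cases "u \<in> X")
    case True
    show ?thesis
      by (rule rank_le_row_update[OF M, where u = u and F = "a u"])
        (use True N uv in \<open>auto simp: set_diag_def\<close>)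
  next
    case False
    show ?thesis
      by (rule rank_le_col_update[OF M, where u = u and F = "a u"])
        (use False N uv in \<open>auto simp: set_diag_def sym[of _ u]\<close>)
  qed
  then show ?thesis using Some by simp
qed

text \<open>\<open>\<tau>\<close> is fixed before \<open>X\<close> and \<open>r\<close>, so that a
  single choice serves all cuts of a layout.\<close>

lemma minor_cut_le_local_compl:
  assumes "loopless_symmetric a" "u \<in> V" "v \<in> V"
  obtains \<tau> where "\<And>X r. X \<subseteq> V - {v} \<Longrightarrow> minor_cut_le \<tau> a V v X r \<Longrightarrow>
    minor_cut_le \<sigma> (local_compl_matrix a u) V v X r"
proof (cases "u = v")
  case True
  show thesis
    by (rule that, unfold True, rule minor_cut_le_local_compl_self[OF assms(1,3)])
next
  case False
  show thesis
    by (rule that, rule minor_cut_le_local_compl_other[OF assms False])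
qed

section \<open>Vertex-minors with one vertex less\<close>

lemma adjacency_local_complement:
  assumes "loopless_symmetric (adjacency G)"
  shows "adjacency (local_complement G u) = local_compl_matrix (adjacency G) u"
proof (intro ext)
  fix x y
  have "(x, x) \<notin> parcs G"
    using assms by (auto simp: loopless_symmetric_def adjacency_def dest: spec[of _ x])
  then show "adjacency (local_complement G u) x y = local_compl_matrix (adjacency G) u x y"
    by (auto simp: adjacency_def local_complement_def local_compl_matrix_def neighborhood_def Let_def)
qed

text \<open>This is an invariant of the operations leading to \<open>H\<close>. While no vertex is
  missing, every removal from \<open>H\<close> is bounded by some removal from \<open>G\<close>;
  once \<open>v\<close> is missing, the cuts of \<open>H\<close> itself are.\<close>

lemma vertex_minor_cut_le:
  assumes "vertex_minor H G" "loopless_symmetric (adjacency G)"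
  defines "V \<equiv> pverts G"
  shows "loopless_symmetric (adjacency H) \<and> pverts H \<subseteq> V \<and>
    (pverts H = V \<longrightarrow> (\<forall>v\<in>V. \<forall>\<sigma>. \<exists>\<tau>. \<forall>X r. X \<subseteq> V - {v} \<longrightarrow>
       minor_cut_le \<tau> (adjacency G) V v X r \<longrightarrow> minor_cut_le \<sigma> (adjacency H) V v X r)) \<and>
    (\<forall>v\<in>V. pverts H = V - {v} \<longrightarrow> (\<exists>\<tau>. \<forall>X r. X \<subseteq> V - {v} \<longrightarrow>
       minor_cut_le \<tau> (adjacency G) V v X r \<longrightarrow> rank_le (adjacency H) X (pverts H - X) r))"
  using assms(1,2) unfolding V_def
proof (induction rule: vertex_minor.induct)
  case (refl G)
  then show ?case by auto
next
  case (delete H G w)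
  let ?V = "pverts G"
  note IH = delete.IH[OF delete.prems]
  have adj: "adjacency (delete_vertex H w) x y = (if x = w \<or> y = w then 0 else adjacency H x y)" for x y
    by (auto simp: adjacency_def delete_vertex_def)
  have "\<exists>\<tau>. \<forall>X r. X \<subseteq> ?V - {v} \<longrightarrow> minor_cut_le \<tau> (adjacency G) ?V v X r \<longrightarrow>
      rank_le (adjacency (delete_vertex H w)) X (pverts (delete_vertex H w) - X) r"
    if v: "v \<in> ?V" "pverts (delete_vertex H w) = ?V - {v}" for v
  proof -
    \<comment> \<open>As only \<open>v\<close> is missing afterwards, this deletion is the first one
      and removes \<open>v\<close>.\<close>
    have eq: "w = v" "pverts H = ?V"
      using v delete.hyps IH by (auto simp: delete_vertex_def)
    obtain \<tau> where \<tau>: "\<And>X r. X \<subseteq> ?V - {v} \<Longrightarrow> minor_cut_le \<tau> (adjacency G) ?V v X r \<Longrightarrow>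
        minor_cut_le None (adjacency H) ?V v X r"
      using IH eq v(1) by meson
    have "rank_le (adjacency (delete_vertex H w)) X (pverts (delete_vertex H w) - X) r"
      if "X \<subseteq> ?V - {v}" "minor_cut_le \<tau> (adjacency G) ?V v X r" for X r
      using \<tau>[OF that] unfolding v(2) minor_cut_le.simps
      by (rule rank_le_cong) (unfold adj, use that(1) eq in auto)
    then show ?thesis by blast
  qed
  moreover have "loopless_symmetric (adjacency (delete_vertex H w))"
    using IH by (auto simp: loopless_symmetric_def adj)
  moreover have "pverts (delete_vertex H w) \<subset> ?V"
    using IH delete.hyps by (auto simp: delete_vertex_def)
  ultimately show ?case by blast
next
  case (complement H G u)
  let ?V = "pverts G"
  note IH = complement.IH[OF complement.prems]
  have ls: "loopless_symmetric (adjacency H)" using IH by blast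
  note adj = adjacency_local_complement[OF ls]
  have pv: "pverts (local_complement H u) = pverts H"
    by (simp add: local_complement_def Let_def)
  have "\<exists>\<tau>. \<forall>X r. X \<subseteq> ?V - {v} \<longrightarrow> minor_cut_le \<tau> (adjacency G) ?V v X r \<longrightarrow>
      minor_cut_le \<sigma> (adjacency (local_complement H u)) ?V v X r"
    if v: "v \<in> ?V" "pverts H = ?V" for v \<sigma>
  proof -
    obtain \<rho> where \<rho>: "\<And>X r. X \<subseteq> ?V - {v} \<Longrightarrow> minor_cut_le \<rho> (adjacency H) ?V v X r \<Longrightarrow>
        minor_cut_le \<sigma> (local_compl_matrix (adjacency H) u) ?V v X r"
      using minor_cut_le_local_compl[OF ls, of u ?V v \<sigma>] complement.hyps v by blast
    obtain \<tau> where \<tau>: "\<And>X r. X \<subseteq> ?V - {v} \<Longrightarrow> minor_cut_le \<tau> (adjacency G) ?V v X r \<Longrightarrow>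
        minor_cut_le \<rho> (adjacency H) ?V v X r"
      using IH v by meson
    show ?thesis unfolding adj using \<rho> \<tau> by blast
  qed
  moreover have "\<exists>\<tau>. \<forall>X r. X \<subseteq> ?V - {v} \<longrightarrow> minor_cut_le \<tau> (adjacency G) ?V v X r \<longrightarrow>
      rank_le (adjacency (local_complement H u)) X (pverts H - X) r"
    if v: "v \<in> ?V" "pverts H = ?V - {v}" for v
  proof -
    obtain \<tau> where \<tau>: "\<And>X r. X \<subseteq> ?V - {v} \<Longrightarrow> minor_cut_le \<tau> (adjacency G) ?V v X r \<Longrightarrow>
        rank_le (adjacency H) X (pverts H - X) r"
      using IH v by meson
    \<comment> \<open>The vertex \<open>u\<close> is still present, on one side of the cut, so its
      row or column is available for the update.\<close>
    have "rank_le (adjacency (local_complement H u)) X (pverts H - X) r"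
      if "X \<subseteq> ?V - {v}" "minor_cut_le \<tau> (adjacency G) ?V v X r" for X r
      unfolding adj using complement.hyps
      by (intro rank_le_local_compl[OF ls _ _ \<tau>[OF that]]) auto
    then show ?thesis by blast
  qed
  ultimately show ?case
    using IH loopless_symmetric_local_compl[OF ls] by (simp add: pv adj)
qed

section \<open>Delta compositions\<close>

text \<open>One matrix and three vertex sets describe the composition, so that the parts can be
  permuted without passing to isomorphic copies.\<close>

locale triangle_sum =
  fixes a :: "'a \<Rightarrow> 'a \<Rightarrow> bit" and A B C :: "'a set" and p q r :: 'a
  assumes disj: "A \<inter> B = {}" "A \<inter> C = {}" "B \<inter> C = {}"
    and tri: "p \<in> A" "q \<in> B" "r \<in> C"
    and sym: "a x y = a y x"
    and AB: "x \<in> A \<Longrightarrow> y \<in> B \<Longrightarrow> a x y = of_bool (x = p \<and> y = q)"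
    and AC: "x \<in> A \<Longrightarrow> y \<in> C \<Longrightarrow> a x y = of_bool (x = p \<and> y = r)"
    and BC: "x \<in> B \<Longrightarrow> y \<in> C \<Longrightarrow> a x y = of_bool (x = q \<and> y = r)"
begin

lemma BA: "x \<in> B \<Longrightarrow> y \<in> A \<Longrightarrow> a x y = of_bool (x = q \<and> y = p)"
  using AB[of y x] sym[of x y] by auto

lemma CA: "x \<in> C \<Longrightarrow> y \<in> A \<Longrightarrow> a x y = of_bool (x = r \<and> y = p)"
  using AC[of y x] sym[of x y] by auto

lemma CB: "x \<in> C \<Longrightarrow> y \<in> B \<Longrightarrow> a x y = of_bool (x = r \<and> y = q)"
  using BC[of y x] sym[of x y] by auto

lemma swap_first: "triangle_sum a B A C q p r"
  using disj tri sym BA BC AC by unfold_locales auto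

lemma swap_last: "triangle_sum a A C B p r q"
  using disj tri sym AB AC CB by unfold_locales auto

text \<open>Outside \<open>B\<close> only \<open>q\<close> has neighbours in \<open>B\<close>, so on
  \<open>X\<close> all columns beyond \<open>B\<close> vanish; column \<open>q\<close> costs
  one.\<close>

lemma cut_in_part:
  assumes "X \<subseteq> B - {q}" "rank_le a X (B - {q} - X) k"
  shows "rank_le a X (A \<union> B \<union> C - X) (Suc k)"
  by (rule rank_le_zero_cols[OF rank_le_insert_col[OF assms(2), of q]])
    (use assms(1) BA BC in \<open>auto simp: subset_iff\<close>)

text \<open>If \<open>p\<close> is not a row, all entries outside the block \<open>X\<close>,
  \<open>Y\<close> lie in row \<open>q\<close>; if \<open>p\<close> is a row, it is not a column and
  they lie in column \<open>r\<close>. \<open>M\<close> stands for \<open>a\<close>, possibly with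
  an altered diagonal entry.\<close>

lemma cut_middle:
  assumes M: "\<And>x y. (x, y) \<noteq> (p, p) \<Longrightarrow> x \<in> B \<or> y \<in> C \<Longrightarrow> M x y = a x y"
    and XY: "X \<subseteq> A" "Y \<subseteq> A" "p \<notin> X \<or> p \<notin> Y"
    and le: "rank_le M X Y k"
  shows "rank_le M (B \<union> X) (Y \<union> C) (Suc k)"
proof -
  have MB: "M x y = a x y" if "x \<in> B" for x y
    using M[of x y] that tri disj by auto
  have MC: "M x y = a x y" if "y \<in> C" for x y
    using M[of x y] that tri disj by auto
  show ?thesis
  proof (cases "p \<in> X")
    case False
    have "rank_le M X (Y \<union> C) k"
      by (rule rank_le_zero_cols[OF le]) (use False XY AC MC in \<open>auto simp: subset_iff\<close>)
    from rank_le_insert_row[OF this, of q] show ?thesis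
      by (rule rank_le_zero_rows) (use XY BA BC MB in \<open>auto simp: subset_iff\<close>)
  next
    case True
    have "rank_le M (B \<union> X) Y k"
      by (rule rank_le_zero_rows[OF le]) (use True XY BA MB in \<open>auto simp: subset_iff\<close>)
    from rank_le_insert_col[OF this, of r] show ?thesis
      by (rule rank_le_zero_cols) (use XY AC BC MC in \<open>auto simp: subset_iff\<close>)
  qed
qed

text \<open>For \<open>x \<noteq> p\<close>, and for deletion, \<open>cut_middle\<close> applies.
  Otherwise \<open>p\<close> is both a row and a column, and the triangle entries have rank one only
  together with the entry at \<open>(p, p)\<close>, which is therefore flipped.\<close>

lemma minor_cut_le_middle:
  assumes x: "x \<in> A" and X: "X \<subseteq> A - {x}"
    and le: "minor_cut_le (if x = p then map_option (\<lambda>t. t + 1) \<sigma> else \<sigma>) a A x X k"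
  shows "minor_cut_le \<sigma> a (A \<union> B \<union> C) x (B \<union> X) (Suc k)"
proof (cases \<sigma>)
  case None
  have "rank_le a X (A - {x} - X) k"
    using None le by (auto split: if_splits)
  then have "rank_le a (B \<union> X) ((A - {x} - X) \<union> C) (Suc k)"
    by (rule cut_middle[rotated -1]) (use X in auto)
  then show ?thesis
    using None by (auto elim!: rank_le_subset)
next
  case (Some t)
  have cols: "A \<union> B \<union> C - (B \<union> X) \<subseteq> A - X \<union> C" by auto
  show ?thesis
  proof (cases "x = p")
    case False
    have "rank_le (set_diag a x t) (B \<union> insert x X) ((A - X) \<union> C) (Suc (Suc k))"
      by (rule cut_middle)
        (use Some False x X le disj in \<open>auto simp: set_diag_def\<close>)
    then show ?thesis
      using Some cols by (auto elim!: rank_le_subset)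
  next
    case True
    \<comment> \<open>\<open>?N\<close> keeps the block of \<open>A\<close> with the flipped entry.
      Adding the all-one block on rows \<open>p\<close>, \<open>q\<close> and columns
      \<open>p\<close>, \<open>r\<close> flips it back and creates the entries of the main
      triangle.\<close>
    let ?N = "\<lambda>x y. if x \<in> B \<or> y \<in> C then 0 else set_diag a p (t + 1) x y"
    have "rank_le (set_diag a p (t + 1)) (insert p X) (A - X) (Suc k)"
      using Some True le by simp
    then have "rank_le ?N (insert p X) (A - X) (Suc k)"
      by (rule rank_le_cong) (use tri X disj in auto)
    then have "rank_le ?N (insert p X) (A - X \<union> C) (Suc k)"
      by (rule rank_le_zero_cols) auto
    then have "rank_le ?N (insert p (B \<union> X)) (A - X \<union> C) (Suc k)"
      by (rule rank_le_zero_rows) auto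
    then have "rank_le (set_diag a p t) (insert p (B \<union> X)) (A - X \<union> C) (Suc (Suc k))"
    proof (rule rank_le_rank_one_update[where F = "\<lambda>x. of_bool (x = p \<or> x = q)"
          and G = "\<lambda>y. of_bool (y = p \<or> y = r)"])
      fix y z assume y: "y \<in> insert p (B \<union> X)" and z: "z \<in> A - X \<union> C"
      have ne: "p \<noteq> q" "p \<noteq> r" "q \<noteq> r" "p \<notin> B" "p \<notin> C" "r \<notin> A" "q \<notin> A" "q \<notin> C" "r \<notin> B"
        using tri disj by auto
      have "y \<in> B \<or> y \<in> A \<and> y \<notin> B" "z \<in> C \<or> z \<in> A \<and> z \<notin> C"
        using y z X tri disj by auto
      then show "set_diag a p t y z = ?N y z + of_bool (y = p \<or> y = q) * of_bool (z = p \<or> z = r)"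
        using ne by (elim disjE conjE) (auto simp: set_diag_def BA BC AC)
    qed
    then show ?thesis
      using Some True cols by (auto elim!: rank_le_subset)
  qed
qed

end

section \<open>Upper bound: layouts after removing a vertex\<close>

text \<open>All three removals are included because the induction exchanges two of them when the
  removed vertex lies on the main triangle.\<close>

definition minors_have_layouts :: "nat \<Rightarrow> ('a \<Rightarrow> 'a \<Rightarrow> bit) \<Rightarrow> 'a set \<Rightarrow> bool" where
  "minors_have_layouts k a V \<longleftrightarrow> (\<forall>v\<in>V. \<forall>\<sigma>. \<exists>vs. distinct vs \<and> set vs = V - {v} \<and>
     (\<forall>xs. prefix xs vs \<longrightarrow> minor_cut_le \<sigma> a V v (set xs) k))"

lemma prefix_append_ConsE:
  assumes "prefix xs (ys @ z # zs)"
  obtains "prefix xs ys" | us where "xs = ys @ z # us" "prefix us zs"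
proof -
  consider "prefix xs ys" | us where "xs = ys @ us" "prefix us (z # zs)"
    using assms unfolding prefix_append by blast
  then show thesis
  proof cases
    case 1
    then show thesis by (rule that(1))
  next
    case 2
    then show thesis using that by (cases us) auto
  qed
qed

lemma prefix_rev_set:
  assumes "prefix xs (rev vs)" "distinct vs"
  obtains ys where "prefix ys vs" "set ys = set vs - set xs"
proof -
  obtain zs where "rev vs = xs @ zs" using assms(1) by (auto simp: prefix_def)
  then have "vs = rev zs @ rev xs" by (metis rev_append rev_rev_ident)
  then show thesis using that[of "rev zs"] assms(2) by auto
qed

context triangle_sum
begin

lemma minor_layout:
  assumes A: "minors_have_layouts k a A" and B: "minors_have_layouts k a B"
    and C: "minors_have_layouts k a C" and x: "x \<in> A"
  shows "\<exists>vs. distinct vs \<and> set vs = A \<union> B \<union> C - {x} \<and>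
     (\<forall>xs. prefix xs vs \<longrightarrow> minor_cut_le \<sigma> a (A \<union> B \<union> C) x (set xs) (Suc k))"
proof -
  let ?V = "A \<union> B \<union> C"
  obtain K where K: "distinct K" "set K = B - {q}"
    and K_cut: "\<And>xs. prefix xs K \<Longrightarrow> minor_cut_le None a B q (set xs) k"
    using B tri unfolding minors_have_layouts_def by meson
  obtain M where M: "distinct M" "set M = C - {r}"
    and M_cut: "\<And>xs. prefix xs M \<Longrightarrow> minor_cut_le None a C r (set xs) k"
    using C tri unfolding minors_have_layouts_def by meson
  \<comment> \<open>The removal from \<open>A\<close> is the one that
    \<open>minor_cut_le_middle\<close> demands for the removal \<open>\<sigma>\<close> from the
    composition.\<close>
  obtain L where L: "distinct L" "set L = A - {x}"
    and L_cut: "\<And>xs. prefix xs L \<Longrightarrow>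
      minor_cut_le (if x = p then map_option (\<lambda>t. t + 1) \<sigma> else \<sigma>) a A x (set xs) k"
    using A x unfolding minors_have_layouts_def by meson
  interpret CB: triangle_sum a A C B p r q by (rule swap_last)
  have xBC: "x \<notin> B" "x \<notin> C" using x disj by auto
  have first: "minor_cut_le \<sigma> a ?V x (set xs) (Suc k)" if "prefix xs K" for xs
  proof -
    have sub: "set xs \<subseteq> B - {q}" using set_mono_prefix[OF that] K(2) by simp
    have "rank_le a (set xs) (?V - set xs) (Suc k)"
      using cut_in_part[OF sub] K_cut[OF that] by simp
    then show ?thesis by (rule minor_cut_le_if_rank_le) (use sub xBC in auto)
  qed
  have middle: "minor_cut_le \<sigma> a ?V x (B \<union> set xs) (Suc k)" if "prefix xs L" for xs
    using minor_cut_le_middle[OF x _ L_cut[OF that]] set_mono_prefix[OF that] L(2) by simp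
  \<comment> \<open>By the reversal of \<open>M\<close>, the other side of such a cut is a prefix of
    \<open>M\<close>; it is bounded like the first segment, with \<open>C\<close> in the role of
    \<open>B\<close>.\<close>
  have last: "minor_cut_le \<sigma> a ?V x (insert r (B \<union> (A - {x}) \<union> set xs)) (Suc k)"
    if "prefix xs (rev M)" for xs
  proof -
    obtain ys where ys: "prefix ys M" "set ys = set M - set xs"
      using prefix_rev_set[OF \<open>prefix xs (rev M)\<close> M(1)] .
    have xs: "set xs \<subseteq> C - {r}" using set_mono_prefix[OF that] M(2) by simp
    have sub: "set ys \<subseteq> C - {r}" using ys(2) M(2) by auto
    have "A \<union> C \<union> B = ?V" by blast
    then have "rank_le a (set ys) (?V - set ys) (Suc k)"
      using CB.cut_in_part[OF sub] M_cut[OF ys(1)] by simp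
    then have cut: "minor_cut_le \<sigma> a ?V x (set ys) (Suc k)"
      by (rule minor_cut_le_if_rank_le) (use sub xBC in auto)
    let ?X = "insert r (B \<union> (A - {x}) \<union> set xs)"
    have "?X \<subseteq> ?V - {x}" using xs xBC tri by auto
    moreover have "?V - {x} - ?X = set ys"
      using ys(2) M(2) disj xBC by auto
    ultimately show ?thesis
      using minor_cut_le_compl[of a x ?V ?X \<sigma> "Suc k", OF sym] x cut by simp
  qed
  let ?vs = "K @ q # L @ r # rev M"
  have "minor_cut_le \<sigma> a ?V x (set xs) (Suc k)" if pre: "prefix xs ?vs" for xs
  proof -
    \<comment> \<open>The cut just after \<open>q\<close> counts as a middle cut with an empty
      prefix of \<open>L\<close>, the one just after \<open>r\<close> as a last cut.\<close>
    have qK: "insert q (set K) = B" using K(2) tri by auto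
    from pre show ?thesis
    proof (rule prefix_append_ConsE)
      assume "prefix xs K"
      then show ?thesis by (rule first)
    next
      fix us assume us: "xs = K @ q # us" "prefix us (L @ r # rev M)"
      from us(2) show ?thesis
      proof (rule prefix_append_ConsE)
        assume "prefix us L"
        moreover have "set xs = B \<union> set us" by (simp add: us(1) flip: qK)
        ultimately show ?thesis using middle by simp
      next
        fix ys assume ys: "us = L @ r # ys" "prefix ys (rev M)"
        have "set xs = insert r (B \<union> (A - {x}) \<union> set ys)"
          by (simp add: us(1) ys(1) L(2) Un_assoc insert_commute flip: qK)
        then show ?thesis using last[OF ys(2)] by simp
      qed
    qed
  qed
  moreover have "q \<notin> A" "q \<notin> C" "r \<notin> A" "r \<notin> B" "q \<noteq> r"
    using tri disj by auto
  then have "distinct ?vs"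
    using disj by (auto simp: K L M)
  moreover have "set ?vs = ?V - {x}"
    using tri xBC by (simp add: K(2) L(2) M(2)) blast
  ultimately show ?thesis by blast
qed

lemma minors_have_layouts:
  assumes "minors_have_layouts k a A" "minors_have_layouts k a B" "minors_have_layouts k a C"
  shows "minors_have_layouts (Suc k) a (A \<union> B \<union> C)"
  unfolding minors_have_layouts_def
proof (intro ballI allI)
  fix x \<sigma> assume "x \<in> A \<union> B \<union> C"
  interpret BA: triangle_sum a B A C q p r by (rule swap_first)
  interpret CA: triangle_sum a C A B r p q
    by (rule triangle_sum.swap_first, rule swap_last)
  have eq: "B \<union> A \<union> C = A \<union> B \<union> C" "C \<union> A \<union> B = A \<union> B \<union> C" by auto
  show "\<exists>vs. distinct vs \<and> set vs = A \<union> B \<union> C - {x} \<and>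
     (\<forall>xs. prefix xs vs \<longrightarrow> minor_cut_le \<sigma> a (A \<union> B \<union> C) x (set xs) (Suc k))"
    using \<open>x \<in> A \<union> B \<union> C\<close> minor_layout[OF assms(1,2,3), of x \<sigma>]
      BA.minor_layout[OF assms(2,1,3), of x \<sigma>, unfolded eq]
      CA.minor_layout[OF assms(3,1,2), of x \<sigma>, unfolded eq] by blast
qed

end

section \<open>Lower bound: every layout has a large cut\<close>

text \<open>Connectedness as edges across cuts supplies the pivot directly. \<open>S\<close> may
  leave \<open>V\<close>, so a prefix of a layout of the whole graph can be inserted.\<close>

definition cut_connected :: "('a \<Rightarrow> 'a \<Rightarrow> 'b :: zero) \<Rightarrow> 'a set \<Rightarrow> bool" where
  "cut_connected a V \<longleftrightarrow>
    (\<forall>S. V \<inter> S \<noteq> {} \<longrightarrow> V - S \<noteq> {} \<longrightarrow> (\<exists>x\<in>V \<inter> S. \<exists>y\<in>V - S. a x y \<noteq> 0))"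

lemma cut_connectedE:
  assumes "cut_connected a V" "V \<inter> S \<noteq> {}" "V - S \<noteq> {}"
  obtains x y where "x \<in> V" "x \<in> S" "y \<in> V" "y \<notin> S" "a x y \<noteq> 0"
  using assms(1)[unfolded cut_connected_def, rule_format, OF assms(2,3)] that by auto

lemma cut_connected_Un:
  assumes "cut_connected a A" "cut_connected a B" "x \<in> A" "y \<in> B" "a x y \<noteq> 0" "a y x \<noteq> 0"
  shows "cut_connected a (A \<union> B)"
  unfolding cut_connected_def
proof (intro allI impI)
  fix S assume S: "(A \<union> B) \<inter> S \<noteq> {}" "(A \<union> B) - S \<noteq> {}"
  show "\<exists>x\<in>(A \<union> B) \<inter> S. \<exists>y\<in>(A \<union> B) - S. a x y \<noteq> 0"
  proof (cases "(A \<inter> S \<noteq> {} \<and> A - S \<noteq> {}) \<or> (B \<inter> S \<noteq> {} \<and> B - S \<noteq> {})")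
    case True
    then obtain u w where "u \<in> A \<union> B" "u \<in> S" "w \<in> A \<union> B" "w \<notin> S" "a u w \<noteq> 0"
      using cut_connectedE[OF assms(1), of S] cut_connectedE[OF assms(2), of S] by (metis UnI1 UnI2)
    then show ?thesis by blast
  next
    case False
    \<comment> \<open>Now \<open>S\<close> separates \<open>A\<close> from \<open>B\<close>, so the
      joining edge crosses it, in one of its two directions.\<close>
    then have "A \<subseteq> S \<and> B \<inter> S = {} \<or> B \<subseteq> S \<and> A \<inter> S = {}" using S by blast
    then show ?thesis using assms(3-6) by blast
  qed
qed

text \<open>Indices beyond the length of \<open>vs\<close> leave no columns, hence rank zero, and
  cannot be witnesses.\<close>

definition layouts_exceed :: "nat \<Rightarrow> ('a \<Rightarrow> 'a \<Rightarrow> 'b :: field) \<Rightarrow> 'a set \<Rightarrow> bool" where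
  "layouts_exceed k a V \<longleftrightarrow> (\<forall>vs. distinct vs \<longrightarrow> set vs = V \<longrightarrow>
     (\<exists>i. \<not> rank_le a (set (take i vs)) (V - set (take i vs)) k))"

lemma take_filter: "\<exists>j. take i (filter P xs) = filter P (take j xs)"
proof (induction xs arbitrary: i)
  case (Cons x xs)
  show ?case
  proof (cases "P x \<and> i = 0")
    case True
    then show ?thesis by (intro exI[of _ 0]) simp
  next
    case False
    obtain j where "take (if P x then i - 1 else i) (filter P xs) = filter P (take j xs)"
      using Cons.IH by blast
    then show ?thesis using False by (intro exI[of _ "Suc j"]) (cases i; auto)
  qed
qed simp

text \<open>Filtering \<open>vs\<close> gives a layout of \<open>A\<close>, and each of its cuts is
  the trace on \<open>A\<close> of a cut of \<open>vs\<close>.\<close>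

lemma layouts_exceed_restrict:
  assumes "layouts_exceed k a A" "distinct vs" "A \<subseteq> set vs"
  obtains i where "\<not> rank_le a (A \<inter> set (take i vs)) (A - set (take i vs)) k"
proof -
  let ?ws = "filter (\<lambda>x. x \<in> A) vs"
  have "distinct ?ws" "set ?ws = A" using assms(2,3) by auto
  then obtain i where i: "\<not> rank_le a (set (take i ?ws)) (A - set (take i ?ws)) k"
    using assms(1) unfolding layouts_exceed_def by blast
  obtain j where "take i ?ws = filter (\<lambda>x. x \<in> A) (take j vs)"
    using take_filter by blast
  moreover have "{x \<in> set (take j vs). x \<in> A} = A \<inter> set (take j vs)"
    "A - A \<inter> set (take j vs) = A - set (take j vs)" by auto
  ultimately show thesis using i that[of j] by auto
qed

context triangle_sum
begin

lemma not_rank_le_Suc: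
  assumes conn: "cut_connected a A" "cut_connected a C"
    and X: "A \<inter> X \<noteq> {}" "C - X \<noteq> {}"
    and B: "\<not> rank_le a (B \<inter> X) (B - X) k"
  shows "\<not> rank_le a ((A \<union> B \<union> C) \<inter> X) (A \<union> B \<union> C - X) (Suc k)"
proof
  assume le: "rank_le a ((A \<union> B \<union> C) \<inter> X) (A \<union> B \<union> C - X) (Suc k)"
  have "cut_connected a (A \<union> C)"
    by (rule cut_connected_Un[OF conn tri(1,3)]) (simp_all add: AC CA tri)
  moreover have "(A \<union> C) \<inter> X \<noteq> {}" "A \<union> C - X \<noteq> {}"
    using X by auto
  ultimately obtain x y where xy: "x \<in> A \<union> C" "x \<in> X" "y \<in> A \<union> C" "y \<notin> X" "a x y \<noteq> 0"
    by (rule cut_connectedE)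
  have "rank_le (\<lambda>u w. a u w - a u y * a x w / a x y) ((A \<union> B \<union> C) \<inter> X) (A \<union> B \<union> C - X) k"
    by (rule rank_le_schur_complement[OF le]) (use xy in auto)
  then have "rank_le (\<lambda>u w. a u w - a u y * a x w / a x y) (B \<inter> X) (B - X) k"
    by (rule rank_le_subset) auto
  then have "rank_le a (B \<inter> X) (B - X) k"
  proof (rule rank_le_cong)
    fix u w assume u: "u \<in> B \<inter> X" and w: "w \<in> B - X"
    \<comment> \<open>The vertex \<open>q\<close> is on one side of the cut only, so one factor of
      the correction vanishes and pivoting leaves the block of \<open>B\<close> intact.\<close>
    then have "u \<noteq> q \<or> w \<noteq> q" by auto
    then have "a u y = 0 \<or> a x w = 0"
      using u w xy(1,3) by (auto simp: BA BC AB CB)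
    then show "a u w = a u w - a u y * a x w / a x y" by auto
  qed
  with B show False ..
qed

lemma layouts_exceed:
  assumes conn: "cut_connected a A" "cut_connected a B" "cut_connected a C"
    and ex: "layouts_exceed k a A" "layouts_exceed k a B" "layouts_exceed k a C"
  shows "layouts_exceed (Suc k) a (A \<union> B \<union> C)"
  unfolding layouts_exceed_def
proof (intro allI impI)
  fix vs assume vs: "distinct vs" "set vs = A \<union> B \<union> C"
  let ?X = "\<lambda>i. set (take i vs)"
  obtain i where i: "\<not> rank_le a (A \<inter> ?X i) (A - ?X i) k"
    using layouts_exceed_restrict[OF ex(1) vs(1)] vs(2) by blast
  obtain j where j: "\<not> rank_le a (B \<inter> ?X j) (B - ?X j) k"
    using layouts_exceed_restrict[OF ex(2) vs(1)] vs(2) by blast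
  obtain l where l: "\<not> rank_le a (C \<inter> ?X l) (C - ?X l) k"
    using layouts_exceed_restrict[OF ex(3) vs(1)] vs(2) by blast
  have mono: "?X m \<subseteq> ?X n" if "m \<le> n" for m n
    using that by (rule set_take_subset_set_take)
  \<comment> \<open>Stated for arbitrary roles of the parts, with \<open>B'\<close> the part whose
    large cut comes in the middle.\<close>
  have main: "\<exists>i. \<not> rank_le a (?X i) (A \<union> B \<union> C - ?X i) (Suc k)"
    if ts: "triangle_sum a A' B' C' p' q' r'" and eq: "A' \<union> B' \<union> C' = A \<union> B \<union> C"
      and conn': "cut_connected a A'" "cut_connected a C'" and le: "m \<le> n" "n \<le> n'"
      and cuts: "\<not> rank_le a (A' \<inter> ?X m) (A' - ?X m) k" "\<not> rank_le a (B' \<inter> ?X n) (B' - ?X n) k"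
        "\<not> rank_le a (C' \<inter> ?X n') (C' - ?X n') k"
    for A' B' C' p' q' r' m n n'
  proof -
    \<comment> \<open>A cut of large rank has vertices on both sides; by monotonicity of prefixes,
      at \<open>n\<close> the part \<open>A'\<close> still has one before the cut and
      \<open>C'\<close> one after it.\<close>
    have "A' \<inter> ?X m \<noteq> {}" "C' - ?X n' \<noteq> {}"
      using cuts(1,3) rank_le_empty by metis+
    then have "A' \<inter> ?X n \<noteq> {}" "C' - ?X n \<noteq> {}"
      using mono[OF le(1)] mono[OF le(2)] by blast+
    then have "\<not> rank_le a ((A' \<union> B' \<union> C') \<inter> ?X n) (A' \<union> B' \<union> C' - ?X n) (Suc k)"
      using triangle_sum.not_rank_le_Suc[OF ts conn'] cuts(2) by blast
    moreover have "(A \<union> B \<union> C) \<inter> ?X n = ?X n"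
      using set_take_subset[of n vs] vs(2) by blast
    ultimately show ?thesis unfolding eq by auto
  qed
  note ABC = triangle_sum_axioms
  note BAC = swap_first note ACB = swap_last
  note BCA = triangle_sum.swap_last[OF BAC] note CAB = triangle_sum.swap_first[OF ACB]
  note CBA = triangle_sum.swap_last[OF CAB]
  consider "i \<le> j" "j \<le> l" | "i \<le> l" "l \<le> j" | "j \<le> i" "i \<le> l"
    | "j \<le> l" "l \<le> i" | "l \<le> i" "i \<le> j" | "l \<le> j" "j \<le> i"
    by linarith
  then show "\<exists>i. \<not> rank_le a (?X i) (A \<union> B \<union> C - ?X i) (Suc k)"
  proof cases
    case 1 then show ?thesis using main[OF ABC _ conn(1,3) _ _ i j l] by auto
  next
    case 2 then show ?thesis using main[OF ACB _ conn(1,2) _ _ i l j] by auto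
  next
    case 3 then show ?thesis using main[OF BAC _ conn(2,3) _ _ j i l] by auto
  next
    case 4 then show ?thesis using main[OF BCA _ conn(2,1) _ _ j l i] by auto
  next
    case 5 then show ?thesis using main[OF CAB _ conn(3,2) _ _ l i j] by auto
  next
    case 6 then show ?thesis using main[OF CBA _ conn(3,1) _ _ l j i] by auto
  qed
qed

lemma cut_connected:
  assumes "cut_connected a A" "cut_connected a B" "cut_connected a C"
  shows "cut_connected a (A \<union> B \<union> C)"
proof -
  have "cut_connected a (A \<union> B)"
    by (rule cut_connected_Un[OF assms(1,2) tri(1,2)]) (simp_all add: AB BA tri)
  then show ?thesis
    by (rule cut_connected_Un[OF _ assms(3), of _ p r]) (simp_all add: AC CA tri)
qed

end

section \<open>Induction over the delta compositions\<close>

lemma (in pair_graph) loopless_symmetric_adjacency: "loopless_symmetric (adjacency G)"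
proof -
  have "(x, x) \<notin> parcs G" for x
    using pair_no_loops[of "(x, x)"] by auto
  then show ?thesis
    by (auto simp: loopless_symmetric_def adjacency_def dest: arcs_symmetric)
qed

text \<open>All three properties read only entries on \<open>V\<close>, so they pass from the
  adjacency matrix of a part to that of the composition.\<close>

lemma
  assumes "\<And>x y. x \<in> V \<Longrightarrow> y \<in> V \<Longrightarrow> b x y = a x y"
  shows minors_have_layouts_cong: "minors_have_layouts k a V \<Longrightarrow> minors_have_layouts k b V"
    and layouts_exceed_cong: "layouts_exceed k a V \<Longrightarrow> layouts_exceed k b V"
    and cut_connected_cong: "cut_connected a V \<Longrightarrow> cut_connected b V"
proof -
  have "minor_cut_le \<sigma> b V v X k" if "minor_cut_le \<sigma> a V v X k" "v \<in> V" "X \<subseteq> V" for \<sigma> v X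
    using that
    by (cases \<sigma>) (auto elim!: rank_le_cong simp: set_diag_def assms subset_iff)
  moreover have "set xs \<subseteq> V" if "prefix xs vs" "set vs = V - {v}" for xs vs v
    using set_mono_prefix[OF that(1)] that(2) by blast
  ultimately show "minors_have_layouts k b V" if "minors_have_layouts k a V"
    using that unfolding minors_have_layouts_def by meson
  have *: "rank_le a (set (take i vs)) (V - set (take i vs)) k"
    if "rank_le b (set (take i vs)) (V - set (take i vs)) k" "set vs = V" for i vs
    by (rule rank_le_cong[OF that(1)]) (use that(2) set_take_subset[of i vs] assms in auto)
  show "layouts_exceed k b V" if "layouts_exceed k a V"
    unfolding layouts_exceed_def
  proof (intro allI impI)
    fix vs assume vs: "distinct vs" "set vs = V"
    then obtain i where "\<not> rank_le a (set (take i vs)) (V - set (take i vs)) k"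
      using \<open>layouts_exceed k a V\<close> unfolding layouts_exceed_def by blast
    then show "\<exists>i. \<not> rank_le b (set (take i vs)) (V - set (take i vs)) k"
      using *[OF _ vs(2)] by blast
  qed
  show "cut_connected b V" if "cut_connected a V"
    using that unfolding cut_connected_def by (simp add: assms)
qed

text \<open>After deletion one side of each cut is empty. In the other cases a single row or column
  is left, of rank at most one, as \<open>Suc 0\<close> permits.\<close>

lemma minors_have_layouts_card_2:
  assumes "card V = 2"
  shows "minors_have_layouts 0 a V"
  unfolding minors_have_layouts_def
proof (intro ballI allI)
  fix v \<sigma> assume "v \<in> V"
  obtain u w where "V = {u, w}" "u \<noteq> w" using assms by (auto simp: card_2_iff)
  then obtain z where "V = {v, z}" "z \<noteq> v"
    using \<open>v \<in> V\<close> by (metis insertE insert_commute singletonD)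
  then have V: "V - {v} = {z}" "V - {z} = {v}" by auto
  have "minor_cut_le \<sigma> a V v X 0" if "X = {} \<or> X = {z}" for X
    using that rank_le_insert_row[of _ "{}"] rank_le_insert_col[of _ _ "{}"]
    by (cases \<sigma>) (auto simp: V)
  then show "\<exists>vs. distinct vs \<and> set vs = V - {v} \<and>
     (\<forall>xs. prefix xs vs \<longrightarrow> minor_cut_le \<sigma> a V v (set xs) 0)"
    by (intro exI[of _ "[z]"]) (auto simp: V prefix_Cons)
qed

lemma Delta_cuts:
  assumes "G \<in> Delta k"
  shows "cut_connected (adjacency G) (pverts G) \<and> layouts_exceed k (adjacency G) (pverts G) \<and>
    minors_have_layouts k (adjacency G) (pverts G)"
  using assms
proof (induction k arbitrary: G)
  case 0
  then have card: "card (pverts G) = 2" and arcs: "parcs G = {(u, v). (u, v) \<in> pverts G \<times> pverts G \<and> u \<noteq> v}"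
    by (auto simp: complete_digraph_def)
  then obtain u w where V: "pverts G = {u, w}" "u \<noteq> w"
    by (auto simp: card_2_iff)
  let ?a = "adjacency G"
  have a: "?a u w = 1" "?a w u = 1" using V arcs by (auto simp: adjacency_def)
  have "cut_connected ?a {u, w}"
    unfolding cut_connected_def
  proof (intro allI impI)
    fix S assume "{u, w} \<inter> S \<noteq> {}" "{u, w} - S \<noteq> {}"
    then have "u \<in> S \<and> w \<notin> S \<or> w \<in> S \<and> u \<notin> S" by auto
    then show "\<exists>x\<in>{u, w} \<inter> S. \<exists>y\<in>{u, w} - S. ?a x y \<noteq> 0" using a by auto
  qed
  moreover have "layouts_exceed 0 ?a {u, w}"
    unfolding layouts_exceed_def
  proof (intro allI impI)
    fix vs assume vs: "distinct vs" "set vs = {u, w}"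
    then have "length vs = 2" using V distinct_card[of vs] by simp
    then obtain x y where "vs = [x, y]" by (auto simp: length_Suc_conv numeral_2_eq_2)
    then have "set (take 1 vs) = {u} \<or> set (take 1 vs) = {w}"
      using vs by auto
    then show "\<exists>i. \<not> rank_le ?a (set (take i vs)) ({u, w} - set (take i vs)) 0"
      using a V by (intro exI[of _ 1]) (auto simp: rank_le_zero_iff)
  qed
  ultimately show ?case
    using minors_have_layouts_card_2[OF card] unfolding V by blast
next
  case (Suc k)
  then obtain G1 G2 G3 H1 H2 H3 :: "'a pair_pre_digraph" and v1 v2 v3
    where in_Delta: "G1 \<in> Delta k" "G2 \<in> Delta k" "G3 \<in> Delta k"
    and iso: "graph_iso G1 H1" "graph_iso G2 H2" "graph_iso G3 H3"
    and disj: "pverts H1 \<inter> pverts H2 = {}" "pverts H1 \<inter> pverts H3 = {}" "pverts H2 \<inter> pverts H3 = {}"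
    and v: "v1 \<in> pverts H1" "v2 \<in> pverts H2" "v3 \<in> pverts H3"
    and G: "G = \<lparr>pverts = pverts H1 \<union> pverts H2 \<union> pverts H3,
           parcs = parcs H1 \<union> parcs H2 \<union> parcs H3 \<union>
             {(v1, v2), (v2, v1), (v1, v3), (v3, v1), (v2, v3), (v3, v2)}\<rparr>"
    by (auto simp: delta_composition_def)
  \<comment> \<open>The disjoint copies belong to \<open>Delta k\<close> themselves, so the
    induction hypothesis applies to them directly.\<close>
  have H: "H1 \<in> Delta k" "H2 \<in> Delta k" "H3 \<in> Delta k"
    using Delta_iso in_Delta iso by blast+
  interpret H1: pair_graph H1 using H(1) by (rule Delta_pair_graph)
  interpret H2: pair_graph H2 using H(2) by (rule Delta_pair_graph)
  interpret H3: pair_graph H3 using H(3) by (rule Delta_pair_graph)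
  interpret G: pair_graph G using Suc.prems by (rule Delta_pair_graph)
  let ?a = "adjacency G"
  note arcs = H1.in_arcsD1 H1.in_arcsD2 H2.in_arcsD1 H2.in_arcsD2 H3.in_arcsD1 H3.in_arcsD2
  interpret triangle_sum ?a "pverts H1" "pverts H2" "pverts H3" v1 v2 v3
  proof
    show "?a x y = ?a y x" for x y
      using G.loopless_symmetric_adjacency by (simp add: loopless_symmetric_def)
  qed (use disj v in \<open>auto simp: adjacency_def G dest: arcs\<close>)
  have part: "cut_connected ?a (pverts K) \<and> layouts_exceed k ?a (pverts K) \<and>
      minors_have_layouts k ?a (pverts K)"
    if "K \<in> Delta k" "\<And>x y. x \<in> pverts K \<Longrightarrow> y \<in> pverts K \<Longrightarrow> ?a x y = adjacency K x y" for K
    using Suc.IH[OF that(1)] that(2)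
      cut_connected_cong[of "pverts K" ?a "adjacency K"]
      layouts_exceed_cong[of "pverts K" ?a "adjacency K"]
      minors_have_layouts_cong[of "pverts K" ?a "adjacency K"] by blast
  have 1: "?a x y = adjacency H1 x y" if "x \<in> pverts H1" "y \<in> pverts H1" for x y
    using that disj v by (auto simp: adjacency_def G dest: arcs)
  have 2: "?a x y = adjacency H2 x y" if "x \<in> pverts H2" "y \<in> pverts H2" for x y
    using that disj v by (auto simp: adjacency_def G dest: arcs)
  have 3: "?a x y = adjacency H3 x y" if "x \<in> pverts H3" "y \<in> pverts H3" for x y
    using that disj v by (auto simp: adjacency_def G dest: arcs)
  have "pverts G = pverts H1 \<union> pverts H2 \<union> pverts H3" by (simp add: G)
  then show ?case
    using part[OF H(1) 1] part[OF H(2) 2] part[OF H(3) 3] cut_connected layouts_exceed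
      minors_have_layouts by auto
qed

section \<open>Linear rank-width\<close>

lemma cutrk_le_iff:
  "finite X \<Longrightarrow> cutrk G X \<le> r \<longleftrightarrow> rank_le (adjacency G) X (pverts G - X) r"
  unfolding cutrk_def by (rule submatrix_rank_le_iff)

text \<open>The index may range over all numbers, and short layouts need no exception, since in each
  additional case one side of the cut is empty.\<close>

lemma layout_width_le_iff:
  assumes "linear_layout G vs"
  shows "layout_width G vs \<le> r \<longleftrightarrow>
    (\<forall>i. rank_le (adjacency G) (set (take i vs)) (pverts G - set (take i vs)) r)"
proof (cases "length vs \<le> 1")
  case True
  have "set (take i vs) = {} \<or> pverts G - set (take i vs) = {}" for i
    using True assms by (cases i) (auto simp: linear_layout_def)
  then have "rank_le (adjacency G) (set (take i vs)) (pverts G - set (take i vs)) r" for i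
    using rank_le_empty by metis
  then show ?thesis using True by (simp add: layout_width_def)
next
  case False
  let ?P = "\<lambda>i. rank_le (adjacency G) (set (take i vs)) (pverts G - set (take i vs)) r"
  have "layout_width G vs \<le> r \<longleftrightarrow> (\<forall>i\<in>{1..length vs}. ?P i)"
    using False by (simp add: layout_width_def cutrk_le_iff)
  also have "\<dots> \<longleftrightarrow> (\<forall>i. ?P i)"
  proof (intro iffI allI)
    fix i assume *: "\<forall>i\<in>{1..length vs}. ?P i"
    have full: "?P (length vs)" using assms by (simp add: linear_layout_def)
    consider "i = 0" | "i \<in> {1..length vs}" | "i \<ge> length vs" by force
    then show "?P i" using * full by cases auto
  qed simp
  finally show ?thesis .
qed

lemma linear_rank_width_le_iff:
  assumes "finite (pverts G)"
  shows "linear_rank_width G \<le> r \<longleftrightarrow> (\<exists>vs. linear_layout G vs \<and> layout_width G vs \<le> r)"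
proof
  obtain vs where "linear_layout G vs"
    using finite_distinct_list[OF assms] by (auto simp: linear_layout_def)
  then have "\<exists>vs. linear_layout G vs \<and> layout_width G vs = linear_rank_width G"
    using LeastI[of "\<lambda>w. \<exists>vs. linear_layout G vs \<and> layout_width G vs = w" "layout_width G vs"]
    unfolding linear_rank_width_def by blast
  then show "\<exists>vs. linear_layout G vs \<and> layout_width G vs \<le> r" if "linear_rank_width G \<le> r"
    using that by metis
next
  assume "\<exists>vs. linear_layout G vs \<and> layout_width G vs \<le> r"
  then obtain vs where "linear_layout G vs" "layout_width G vs \<le> r" by blast
  moreover from this have "linear_rank_width G \<le> layout_width G vs"
    unfolding linear_rank_width_def by (intro Least_le) blast
  ultimately show "linear_rank_width G \<le> r" by simp
qed

theorem theorem3p1: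
  fixes k :: nat and G :: "'a pair_pre_digraph"
  assumes "G \<in> Delta k"
  shows "linear_rank_width G > k \<and>
    (\<forall>H. vertex_minor H G \<and> card (pverts H) + 1 = card (pverts G) \<longrightarrow> linear_rank_width H \<le> k)"
proof (intro conjI allI impI)
  interpret pair_graph G using assms by (rule Delta_pair_graph)
  let ?V = "pverts G"
  have exceed: "layouts_exceed k (adjacency G) ?V" and minors: "minors_have_layouts k (adjacency G) ?V"
    using Delta_cuts[OF assms] by auto
  have "\<not> layout_width G vs \<le> k" if "linear_layout G vs" for vs
    using exceed that unfolding layout_width_le_iff[OF that]
    by (auto simp: layouts_exceed_def linear_layout_def)
  then show "linear_rank_width G > k"
    using linear_rank_width_le_iff[of G k] by (auto simp: not_le[symmetric])
  fix H assume "vertex_minor H G \<and> card (pverts H) + 1 = card ?V"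
  then have minor: "vertex_minor H G" and card: "card (pverts H) + 1 = card ?V" by auto
  note cuts = vertex_minor_cut_le[OF minor loopless_symmetric_adjacency]
  have sub: "pverts H \<subseteq> ?V" using cuts by blast
  then have "card (?V - pverts H) = 1"
    using card by (simp add: card_Diff_subset finite_subset)
  then obtain v where "?V - pverts H = {v}" by (rule card_1_singletonE)
  then have v: "v \<in> ?V" "pverts H = ?V - {v}" using sub by auto
  \<comment> \<open>As \<open>\<tau>\<close> does not depend on the cut, the one layout that
    \<open>minors\<close> gives for it bounds every cut of \<open>H\<close>.\<close>
  obtain \<tau> where \<tau>: "\<And>X r. X \<subseteq> ?V - {v} \<Longrightarrow> minor_cut_le \<tau> (adjacency G) ?V v X r \<Longrightarrow>
      rank_le (adjacency H) X (pverts H - X) r"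
    using cuts v by meson
  obtain vs where vs: "distinct vs" "set vs = ?V - {v}"
    and cut: "\<And>xs. prefix xs vs \<Longrightarrow> minor_cut_le \<tau> (adjacency G) ?V v (set xs) k"
    using minors v(1) unfolding minors_have_layouts_def by meson
  have layout: "linear_layout H vs" using vs v by (simp add: linear_layout_def)
  have "rank_le (adjacency H) (set (take i vs)) (pverts H - set (take i vs)) k" for i
    using \<tau>[OF _ cut[OF take_is_prefix]] set_take_subset[of i vs] vs(2) by simp
  then have "layout_width H vs \<le> k"
    by (simp add: layout_width_le_iff[OF layout])
  moreover have "finite (pverts H)" using sub pair_finite_verts by (rule finite_subset)
  ultimately show "linear_rank_width H \<le> k"
    using layout linear_rank_width_le_iff by blast
qed

end
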